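(* There exists $\omega^*\in(0,1)\setminus\mathbb{Q}$ which is a semi-Brjuno number but not a Brjuno number.
   Context: For irrational $\omega\in(0,1)$ with continued fraction expansion $\omega=[a_1,a_2,\ldots]$ (partial quotients $a_j\geqslant1$), $p_n/q_n$ denotes its $n$-th convergent (reduced fraction, obtained by truncating the expansion at $a_n$). $\omega$ is a Brjuno number if $\sum_{n=1}^\infty\frac{\log q_{n+1}}{q_n}<\infty$. For $\Delta>0$ let $\mathfrak{Brj}_1(\Delta)=\sum_{n=1}^\infty e^{-q_n\Delta}q_{n+1}$ and $\mathfrak{Brj}_2(\Delta)=\sum_{n=1}^\infty e^{-q_n\Delta}q_{n+1}\log a_{n+1}$. $\omega$ is a semi-Brjuno number if for every $\Delta>0$ both $\mathfrak{Brj}_1(\Delta)$ and $\mathfrak{Brj}_2(2\Delta)$ converge. *)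

theory Defs
  imports Complex_Main
begin

text \<open>
  Continued fraction expansion \<open>\<omega> = [a\<^sub>1, a\<^sub>2, \<dots>] = 1 / (a\<^sub>1 + 1 / (a\<^sub>2 + \<dots>))\<close> of an irrational
  \<open>\<omega>\<close> in the open interval \<open>(0, 1)\<close>, obtained by iterating the Gauss map \<open>x \<mapsto> frac (1 / x)\<close>.
  The definitions are meaningful only for such \<open>\<omega>\<close>.
\<close>

definition gauss_iter :: "real \<Rightarrow> nat \<Rightarrow> real" where
  "gauss_iter \<omega> n = ((\<lambda>x. frac (1 / x)) ^^ n) \<omega>"

text \<open>Partial quotients are indexed from 1; index 0 carries no meaning.\<close>

definition partial_quotient :: "real \<Rightarrow> nat \<Rightarrow> int" where
  "partial_quotient \<omega> n = \<lfloor>1 / gauss_iter \<omega> (n - 1)\<rfloor>"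

fun finite_cfrac :: "int list \<Rightarrow> rat" where
  "finite_cfrac [] = 0"
| "finite_cfrac (a # as) = 1 / (of_int a + finite_cfrac as)"

definition convergent_frac :: "real \<Rightarrow> nat \<Rightarrow> rat" where
  "convergent_frac \<omega> n = finite_cfrac (map (partial_quotient \<omega>) [1..<Suc n])"

text \<open>\<open>quotient_of\<close> returns the reduced fraction with positive denominator.\<close>

definition convergent_denom :: "real \<Rightarrow> nat \<Rightarrow> int" where
  "convergent_denom \<omega> n = snd (quotient_of (convergent_frac \<omega> n))"

definition brjuno_term :: "real \<Rightarrow> nat \<Rightarrow> real" where
  "brjuno_term \<omega> n = ln (of_int (convergent_denom \<omega> (n + 1))) / of_int (convergent_denom \<omega> n)"

definition brj1_term :: "real \<Rightarrow> real \<Rightarrow> nat \<Rightarrow> real" where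
  "brj1_term \<omega> \<Delta> n =
     exp (- of_int (convergent_denom \<omega> n) * \<Delta>) * of_int (convergent_denom \<omega> (n + 1))"

definition brj2_term :: "real \<Rightarrow> real \<Rightarrow> nat \<Rightarrow> real" where
  "brj2_term \<omega> \<Delta> n =
     exp (- of_int (convergent_denom \<omega> n) * \<Delta>) * of_int (convergent_denom \<omega> (n + 1))
       * ln (of_int (partial_quotient \<omega> (n + 1)))"

text \<open>All series start at \<open>n = 1\<close>, hence the shift by \<open>Suc\<close>.\<close>

definition brjuno :: "real \<Rightarrow> bool" where
  "brjuno \<omega> \<longleftrightarrow> summable (\<lambda>n. brjuno_term \<omega> (Suc n))"

definition semi_brjuno :: "real \<Rightarrow> bool" where
  "semi_brjuno \<omega> \<longleftrightarrow>
     (\<forall>\<Delta>>0. summable (\<lambda>n. brj1_term \<omega> \<Delta> (Suc n)) \<and>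
            summable (\<lambda>n. brj2_term \<omega> (2 * \<Delta>) (Suc n)))"

end

theory Submission
  imports Defs "HOL-Analysis.Analysis"
begin

text \<open>
  Prescribe the partial quotients recursively by \<open>a\<^sub>n\<^sub>+\<^sub>1 = \<lceil>exp (q\<^sub>n / (n + 1))\<rceil>\<close>. Then
  \<open>q\<^sub>n\<^sub>+\<^sub>1 \<ge> exp (q\<^sub>n / (n + 1))\<close>, so the Brjuno series dominates the harmonic series. Conversely
  \<open>q\<^sub>n\<^sub>+\<^sub>1 \<le> 3 q\<^sub>n exp (q\<^sub>n / (n + 1))\<close> and \<open>ln a\<^sub>n\<^sub>+\<^sub>1 \<le> 2 q\<^sub>n\<close>, so for every \<open>\<Delta> > 0\<close> the exponential
  \<open>exp (- q\<^sub>n \<Delta>)\<close> eventually beats the terms of both semi-Brjuno series. A number with the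
  prescribed expansion lies in the intersection of the nested compact cylinders.
\<close>

section \<open>Numbers with prescribed partial quotients\<close>

text \<open>The numbers \<open>1 / (a 0 + 1 / (a 1 + ... + 1 / (a (n - 1) + y)))\<close> with y in
  the closed unit interval; closedness gives compactness. Peeling off the leading quotient matches
  one step of the Gauss map. Indices start at 0, unlike those of
  \<open>partial_quotient\<close>.\<close>

primrec cylinder :: "(nat \<Rightarrow> int) \<Rightarrow> nat \<Rightarrow> real set" where
  "cylinder a 0 = {0..1}"
| "cylinder a (Suc n) = (\<lambda>y. 1 / (of_int (a 0) + y)) ` cylinder (\<lambda>k. a (Suc k)) n"

lemma cylinder_subset:
  assumes "\<forall>k. a k \<ge> 1"
  shows "cylinder a n \<subseteq> {0..1}"
  using assms
proof (induction n arbitrary: a)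
  case (Suc n)
  have "cylinder (\<lambda>k. a (Suc k)) n \<subseteq> {0..1}" using Suc.prems by (intro Suc.IH) simp
  moreover have "real_of_int (a 0) \<ge> 1" using Suc.prems by simp
  moreover have "1 / (real_of_int (a 0) + y) \<in> {0..1}"
    if "real_of_int (a 0) \<ge> 1" "y \<in> {0..1}" for y :: real
    using that by (simp add: divide_le_eq)
  ultimately show ?case by (auto simp del: atLeastAtMost_iff)
qed simp

lemma compact_cylinder:
  assumes "\<forall>k. a k \<ge> 1"
  shows "compact (cylinder a n)"
  using assms
proof (induction n arbitrary: a)
  case (Suc n)
  have "cylinder (\<lambda>k. a (Suc k)) n \<subseteq> {0..1}" using Suc.prems by (intro cylinder_subset) simp
  moreover have "real_of_int (a 0) \<ge> 1" using Suc.prems by simp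
  ultimately have "\<forall>y\<in>cylinder (\<lambda>k. a (Suc k)) n. of_int (a 0) + y \<noteq> 0" by force
  then have "continuous_on (cylinder (\<lambda>k. a (Suc k)) n) (\<lambda>y. 1 / (of_int (a 0) + y))"
    by (intro continuous_intros)
  moreover have "compact (cylinder (\<lambda>k. a (Suc k)) n)"
    using Suc.prems by (intro Suc.IH) simp
  ultimately show ?case unfolding cylinder.simps by (rule compact_continuous_image)
qed simp

lemma cylinder_nonempty: "cylinder a n \<noteq> {}"
  by (induction n arbitrary: a) auto

lemma cylinder_Suc_subset:
  assumes "\<forall>k. a k \<ge> 1"
  shows "cylinder a (Suc n) \<subseteq> cylinder a n"
  using assms
proof (induction n arbitrary: a)
  case 0
  then show ?case using cylinder_subset[of a "Suc 0"] by simp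
next
  case (Suc n)
  have "cylinder (\<lambda>k. a (Suc k)) (Suc n) \<subseteq> cylinder (\<lambda>k. a (Suc k)) n"
    using Suc.prems by (intro Suc.IH) simp
  then show ?case
    unfolding cylinder.simps(2)[of a] by (rule image_mono)
qed

lemma Inter_cylinder_nonempty:
  assumes "\<forall>k. a k \<ge> 1"
  shows "(\<Inter>n. cylinder a n) \<noteq> {}"
proof (rule compact_nest)
  fix m n :: nat assume "m \<le> n"
  then show "cylinder a n \<subseteq> cylinder a m"
    by (induction rule: dec_induct) (use cylinder_Suc_subset[OF assms] in blast)+
qed (use assms compact_cylinder cylinder_nonempty in auto)

lemma Inter_cylinder_step:
  assumes \<omega>: "\<omega> \<in> (\<Inter>n. cylinder a n)"
  obtains y where "\<omega> = 1 / (of_int (a 0) + y)" "y \<in> (\<Inter>n. cylinder (\<lambda>k. a (Suc k)) n)"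
proof
  define y where "y = 1 / \<omega> - of_int (a 0)"
  have *: "\<omega> = 1 / (of_int (a 0) + y) \<and> y \<in> cylinder (\<lambda>k. a (Suc k)) n" for n
  proof -
    have "\<omega> \<in> cylinder a (Suc n)" using \<omega> by blast
    then obtain z where z: "\<omega> = 1 / (of_int (a 0) + z)" "z \<in> cylinder (\<lambda>k. a (Suc k)) n"
      by auto
    \<comment> \<open>Thus y does not depend on n. Since \<open>1 / 0 = 0\<close>, inverting twice
      gives back a 0 + z even if it is 0.\<close>
    then have "y = z" by (simp add: y_def)
    with z show ?thesis by simp
  qed
  show "\<omega> = 1 / (of_int (a 0) + y)" "y \<in> (\<Inter>n. cylinder (\<lambda>k. a (Suc k)) n)"
    using * by auto
qed

lemma Inter_cylinder_pos:
  assumes a: "\<forall>k. a k \<ge> 1" and \<omega>: "\<omega> \<in> (\<Inter>n. cylinder a n)"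
  shows "\<omega> > 0"
proof -
  obtain y where y: "\<omega> = 1 / (of_int (a 0) + y)" "y \<in> (\<Inter>n. cylinder (\<lambda>k. a (Suc k)) n)"
    using \<omega> by (rule Inter_cylinder_step)
  have "y \<in> cylinder (\<lambda>k. a (Suc k)) 0" using y(2) by blast
  then show ?thesis using y(1) a[rule_format, of 0] by simp
qed

text \<open>A single cylinder may contain the endpoint 1. For a point of all cylinders the tail y
  again lies in such an intersection, so y is positive and a 0 + y exceeds 1.\<close>

lemma Inter_cylinder_less_1:
  assumes a: "\<forall>k. a k \<ge> 1" and \<omega>: "\<omega> \<in> (\<Inter>n. cylinder a n)"
  shows "\<omega> < 1"
proof -
  obtain y where y: "\<omega> = 1 / (of_int (a 0) + y)" "y \<in> (\<Inter>n. cylinder (\<lambda>k. a (Suc k)) n)"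
    using \<omega> by (rule Inter_cylinder_step)
  have "real_of_int (a 0) \<ge> 1" using a by simp
  moreover have "y > 0" using a by (intro Inter_cylinder_pos[OF _ y(2)]) simp
  ultimately show ?thesis using y(1) by simp
qed

text \<open>The strict bounds 0 < y < 1 on the tail make a 0 the integer part and y the fractional
  part of 1 / \<omega>, so the Gauss map acts as the shift of quotients.\<close>

lemma gauss_map_cylinder:
  assumes a: "\<forall>k. a k \<ge> 1" and \<omega>: "\<omega> \<in> (\<Inter>n. cylinder a n)"
  shows "\<lfloor>1 / \<omega>\<rfloor> = a 0" "frac (1 / \<omega>) \<in> (\<Inter>n. cylinder (\<lambda>k. a (Suc k)) n)"
proof -
  obtain y where y: "\<omega> = 1 / (of_int (a 0) + y)" "y \<in> (\<Inter>n. cylinder (\<lambda>k. a (Suc k)) n)"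
    using \<omega> by (rule Inter_cylinder_step)
  have "0 < y" "y < 1"
    using a by (auto intro!: Inter_cylinder_pos[OF _ y(2)] Inter_cylinder_less_1[OF _ y(2)])
  then show floor: "\<lfloor>1 / \<omega>\<rfloor> = a 0" using y(1) by (simp add: floor_unique)
  show "frac (1 / \<omega>) \<in> (\<Inter>n. cylinder (\<lambda>k. a (Suc k)) n)"
    unfolding frac_def floor using y by simp
qed

section \<open>Iterates of the Gauss map and irrationality\<close>

lemma gauss_iter_Suc: "gauss_iter \<omega> (Suc n) = frac (1 / gauss_iter \<omega> n)"
  by (simp add: gauss_iter_def)

lemma gauss_iter_Suc': "gauss_iter \<omega> (Suc n) = gauss_iter (frac (1 / \<omega>)) n"
  unfolding gauss_iter_def funpow_Suc_right by simp

lemma gauss_iter_in_cylinder: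
  assumes a: "\<forall>k. a k \<ge> 1" and \<omega>: "\<omega> \<in> (\<Inter>n. cylinder a n)"
  shows "gauss_iter \<omega> n \<in> (\<Inter>m. cylinder (\<lambda>k. a (k + n)) m)"
proof (induction n)
  case 0
  then show ?case using \<omega> by (simp add: gauss_iter_def)
next
  case (Suc n)
  have "\<forall>k. a (k + n) \<ge> 1" using a by blast
  from gauss_map_cylinder(2)[OF this Suc.IH] show ?case
    unfolding gauss_iter_Suc by simp
qed

text \<open>On rationals the Gauss map is Euclid's algorithm: the image of p/q has denominator p <
  q, so the descent on q must stop at 0.\<close>

lemma gauss_iter_rational_eq_0:
  fixes p :: int and q :: nat
  assumes "\<omega> = of_int p / of_nat q" "0 \<le> \<omega>" "\<omega> < 1"
  shows "\<exists>n. gauss_iter \<omega> n = 0"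
  using assms
proof (induction q arbitrary: p \<omega> rule: less_induct)
  case (less q)
  show ?case
  proof (cases "\<omega> = 0")
    case True
    then show ?thesis by (intro exI[of _ 0]) (simp add: gauss_iter_def)
  next
    case False
    \<comment> \<open>For q = 0 the convention \<open>x / 0 = 0\<close> would give \<omega> =
      0.\<close>
    then have q: "q > 0" using less.prems(1) by (cases q) auto
    have p: "0 < p" using False less.prems(1,2) q by (auto simp: zero_le_divide_iff)
    have "p < int q"
      using less.prems(1,3) q
      by (simp add: divide_less_eq flip: of_int_less_iff[where 'a = real])
    then have lt: "nat p < q" using p by simp
    have "1 / \<omega> = real q / of_int p" using less.prems(1) by simp
    then have "frac (1 / \<omega>) = of_int (int q - \<lfloor>1 / \<omega>\<rfloor> * p) / of_nat (nat p)"
      using p by (simp add: frac_def diff_divide_distrib)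
    from less.IH[OF lt this] obtain n where "gauss_iter (frac (1 / \<omega>)) n = 0"
      using frac_lt_1 frac_ge_0 by blast
    then show ?thesis by (intro exI[of _ "Suc n"]) (simp only: gauss_iter_Suc')
  qed
qed

theorem exists_irrational_with_partial_quotients:
  fixes a :: "nat \<Rightarrow> int"
  assumes a: "\<forall>n\<ge>1. a n \<ge> 1"
  obtains \<omega> where "\<omega> \<in> {0<..<1} - \<rat>" "\<forall>n\<ge>1. partial_quotient \<omega> n = a n"
proof -
  define b where "b = (\<lambda>k. a (Suc k))"
  have b: "\<forall>k. b k \<ge> 1" using a by (simp add: b_def)
  obtain \<omega> where \<omega>: "\<omega> \<in> (\<Inter>n. cylinder b n)" using Inter_cylinder_nonempty[OF b] by auto
  have iter: "gauss_iter \<omega> n \<in> (\<Inter>m. cylinder (\<lambda>k. b (k + n)) m)" for n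
    by (rule gauss_iter_in_cylinder[OF b \<omega>])
  have bounds: "0 < \<omega>" "\<omega> < 1"
    using Inter_cylinder_pos[OF b \<omega>] Inter_cylinder_less_1[OF b \<omega>] by auto
  have nonzero: "gauss_iter \<omega> n \<noteq> 0" for n
  proof -
    have "\<forall>k. b (k + n) \<ge> 1" using b by blast
    from Inter_cylinder_pos[OF this iter] show ?thesis by simp
  qed
  \<comment> \<open>The Gauss orbit of a rational point reaches 0, but here every iterate lies in an
    intersection of cylinders and is positive.\<close>
  have "\<omega> \<notin> \<rat>"
  proof
    assume "\<omega> \<in> \<rat>"
    then obtain p :: int and q :: nat where "\<omega> = of_int p / of_nat q"
      by (auto simp: Rats_eq_int_div_nat)
    from gauss_iter_rational_eq_0[OF this] show False using bounds nonzero by auto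
  qed
  moreover have "partial_quotient \<omega> n = a n" if "n \<ge> 1" for n
  proof -
    have "\<forall>k. b (k + (n - 1)) \<ge> 1" using b by blast
    from gauss_map_cylinder(1)[OF this iter] that show ?thesis
      by (simp add: partial_quotient_def b_def)
  qed
  ultimately show ?thesis using that bounds by auto
qed

section \<open>Convergents\<close>

text \<open>
  Indices are shifted by one against the usual notation: \<open>cf_num a (n + 1)\<close> is \<open>p\<^sub>n\<close> and
  \<open>cf_den a (n + 1)\<close> is \<open>q\<^sub>n\<close>, so that the recursion starts from \<open>p\<^sub>-\<^sub>1 = 1\<close> and \<open>q\<^sub>-\<^sub>1 = 0\<close>.
\<close>

fun cf_num :: "(nat \<Rightarrow> int) \<Rightarrow> nat \<Rightarrow> int" where
  "cf_num a 0 = 1"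
| "cf_num a (Suc 0) = 0"
| "cf_num a (Suc (Suc n)) = a (Suc n) * cf_num a (Suc n) + cf_num a n"

fun cf_den :: "(nat \<Rightarrow> int) \<Rightarrow> nat \<Rightarrow> int" where
  "cf_den a 0 = 0"
| "cf_den a (Suc 0) = 1"
| "cf_den a (Suc (Suc n)) = a (Suc n) * cf_den a (Suc n) + cf_den a n"

lemma cf_den_nonneg_pos:
  assumes "\<forall>n\<ge>1. a n \<ge> 1"
  shows "cf_den a n \<ge> 0 \<and> cf_den a (Suc n) \<ge> 1"
proof (induction n)
  case (Suc n)
  have "a (Suc n) \<ge> 1" using assms by simp
  then have "1 * 1 \<le> a (Suc n) * cf_den a (Suc n)"
    using Suc by (intro mult_mono) auto
  then show ?case using Suc by simp
qed simp

lemma cf_den_le_Suc: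
  assumes "\<forall>n\<ge>1. a n \<ge> 1"
  shows "cf_den a n \<le> cf_den a (Suc n)"
proof (cases n)
  case (Suc m)
  have "1 * cf_den a (Suc m) \<le> a (Suc m) * cf_den a (Suc m)"
    using cf_den_nonneg_pos[OF assms, of m] assms by (intro mult_right_mono) auto
  then show ?thesis
    unfolding Suc cf_den.simps using cf_den_nonneg_pos[OF assms, of m] by linarith
qed simp

lemma cf_den_ge_index:
  assumes a: "\<forall>n\<ge>1. a n \<ge> 1"
  shows "cf_den a (Suc n) \<ge> int n"
proof (induction n)
  case (Suc n)
  have "1 * cf_den a (Suc n) \<le> a (Suc n) * cf_den a (Suc n)"
    using cf_den_nonneg_pos[OF a, of n] a by (intro mult_right_mono) auto
  \<comment> \<open>The summand \<open>cf_den a n\<close> supplies the increment 1 unless n = 0;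
    there \<open>cf_den a 1 = 1\<close> already suffices.\<close>
  moreover have "n = 0 \<or> cf_den a n \<ge> 1"
    using cf_den_nonneg_pos[OF a, of "n - 1"] by (cases n) auto
  moreover have "cf_den a (Suc n) \<ge> 1 \<and> cf_den a n \<ge> 0"
    using cf_den_nonneg_pos[OF a, of n] by simp
  ultimately show ?case
    unfolding cf_den.simps using Suc by (elim disjE) linarith+
qed simp

text \<open>Each step of the recurrence multiplies the matrix of two consecutive convergents by a
  matrix of determinant -1.\<close>

lemma cf_num_den_det: "cf_num a n * cf_den a (Suc n) - cf_num a (Suc n) * cf_den a n = (-1) ^ n"
proof (induction n)
  case (Suc n)
  have "cf_num a (Suc n) * cf_den a (Suc (Suc n)) - cf_num a (Suc (Suc n)) * cf_den a (Suc n) =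
      - (cf_num a n * cf_den a (Suc n) - cf_num a (Suc n) * cf_den a n)"
    by (simp add: algebra_simps)
  then show ?case using Suc by simp
qed simp

lemma coprime_cf_num_den: "coprime (cf_num a n) (cf_den a n)"
proof (rule coprimeI)
  fix d assume "d dvd cf_num a n" "d dvd cf_den a n"
  then have "d dvd cf_num a n * cf_den a (Suc n) - cf_num a (Suc n) * cf_den a n" by simp
  then show "is_unit d" unfolding cf_num_den_det
    by (metis dvd_trans is_unit_power_iff dvd_minus_iff dvd_refl)
qed

text \<open>The free tail x makes the induction work: the last quotient and x merge into the new
  tail 1 / c with c = a (n + 1) + x. At x = 0 this is the formula for the n-th convergent.\<close>

lemma foldr_cfrac_eq:
  fixes x :: rat
  assumes a: "\<forall>n\<ge>1. a n \<ge> 1" and "x \<ge> 0"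
  shows "foldr (\<lambda>a y. 1 / (of_int a + y)) (map a [1..<Suc n]) x =
    (of_int (cf_num a (Suc n)) + x * of_int (cf_num a n)) /
    (of_int (cf_den a (Suc n)) + x * of_int (cf_den a n))"
  using \<open>x \<ge> 0\<close>
proof (induction n arbitrary: x)
  case (Suc n)
  define c where "c = rat_of_int (a (Suc n)) + x"
  have "rat_of_int (a (Suc n)) \<ge> 1" using a by simp
  then have c: "c > 0" using Suc.prems by (simp add: c_def)
  have "foldr (\<lambda>a y. 1 / (of_int a + y)) (map a [1..<Suc (Suc n)]) x =
      foldr (\<lambda>a y. 1 / (of_int a + y)) (map a [1..<Suc n]) (1 / c)"
    by (simp add: c_def)
  also have "\<dots> = (of_int (cf_num a (Suc n)) + 1 / c * of_int (cf_num a n)) /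
      (of_int (cf_den a (Suc n)) + 1 / c * of_int (cf_den a n))"
    using c by (intro Suc.IH) simp
  \<comment> \<open>Clearing 1 / c exposes the recurrence in numerator and denominator.\<close>
  also have "\<dots> = (c * (of_int (cf_num a (Suc n)) + 1 / c * of_int (cf_num a n))) /
      (c * (of_int (cf_den a (Suc n)) + 1 / c * of_int (cf_den a n)))"
    using c by simp
  also have "\<dots> = (of_int (cf_num a (Suc (Suc n))) + x * of_int (cf_num a (Suc n))) /
    (of_int (cf_den a (Suc (Suc n))) + x * of_int (cf_den a (Suc n)))"
    using c by (simp add: distrib_left) (simp add: c_def algebra_simps)
  finally show ?case .
qed simp

lemma finite_cfrac_eq_foldr: "finite_cfrac as = foldr (\<lambda>a y. 1 / (of_int a + y)) as 0"
  by (induction as) auto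

text \<open>The fraction from the recurrence is coprime with positive denominator, so
  \<open>quotient_of\<close> returns it unchanged.\<close>

lemma convergent_denom_eq_cf_den:
  assumes a: "\<forall>n\<ge>1. a n \<ge> 1" and \<omega>: "\<forall>n\<ge>1. partial_quotient \<omega> n = a n"
  shows "convergent_denom \<omega> n = cf_den a (Suc n)"
proof -
  have "map (partial_quotient \<omega>) [1..<Suc n] = map a [1..<Suc n]"
    by (rule map_cong) (use \<omega> in auto)
  then have "convergent_frac \<omega> n = of_int (cf_num a (Suc n)) / of_int (cf_den a (Suc n))"
    unfolding convergent_frac_def finite_cfrac_eq_foldr
    by (simp only: foldr_cfrac_eq[OF a, of 0 n]) simp
  then have "convergent_frac \<omega> n = Fract (cf_num a (Suc n)) (cf_den a (Suc n))"
    by (simp add: Fract_of_int_quotient)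
  then have "quotient_of (convergent_frac \<omega> n) = (cf_num a (Suc n), cf_den a (Suc n))"
    using cf_den_nonneg_pos[OF a, of n] coprime_cf_num_den[of a "Suc n"]
    by (auto simp: quotient_of_Fract normalize_stable)
  then show ?thesis by (simp add: convergent_denom_def)
qed

section \<open>Exponentially growing denominators\<close>

text \<open>With the index shift of \<open>cf_den\<close>, \<open>liouville_den (n + 1)\<close> is
  \<open>q\<^sub>n\<close>. Quotients and denominators depend on each other; writing the quotient
  out inside the recursion avoids a mutual definition.\<close>

fun liouville_den :: "nat \<Rightarrow> int" where
  "liouville_den 0 = 0"
| "liouville_den (Suc 0) = 1"
| "liouville_den (Suc (Suc n)) =
     \<lceil>exp (of_int (liouville_den (Suc n)) / of_nat (Suc n) :: real)\<rceil> * liouville_den (Suc n) +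
     liouville_den n"

definition liouville_quotient :: "nat \<Rightarrow> int" where
  "liouville_quotient n = \<lceil>exp (of_int (liouville_den n) / of_nat n :: real)\<rceil>"

text \<open>This closes the circle: the denominators produced by the quotients are those from which
  the quotients were built.\<close>

lemma cf_den_liouville_quotient: "cf_den liouville_quotient n = liouville_den n"
  by (induction n rule: liouville_den.induct) (simp_all add: liouville_quotient_def)

lemma liouville_quotient_ge_1: "\<forall>n\<ge>1. liouville_quotient n \<ge> 1"
  by (simp add: liouville_quotient_def)

text \<open>Collects what the convergence estimates use. The two-sided bound on
  \<open>q\<^sub>n\<^sub>+\<^sub>1\<close> comes from the recurrence and
  \<open>0 \<le> q\<^sub>n\<^sub>-\<^sub>1 \<le> q\<^sub>n\<close>.\<close>

lemma exists_irrational_with_exponential_denominators: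
  obtains \<omega> where "\<omega> \<in> {0<..<1} - \<rat>"
    "\<And>n. convergent_denom \<omega> n \<ge> 1" "\<And>n. convergent_denom \<omega> n \<ge> int n"
    "\<And>n. partial_quotient \<omega> (n + 1) =
      \<lceil>exp (of_int (convergent_denom \<omega> n) / of_nat (n + 1) :: real)\<rceil>"
    "\<And>n. convergent_denom \<omega> (n + 1) \<ge> partial_quotient \<omega> (n + 1) * convergent_denom \<omega> n"
    "\<And>n. convergent_denom \<omega> (n + 1) \<le> (partial_quotient \<omega> (n + 1) + 1) * convergent_denom \<omega> n"
proof -
  let ?a = liouville_quotient
  obtain \<omega> where \<omega>: "\<omega> \<in> {0<..<1} - \<rat>" "\<forall>n\<ge>1. partial_quotient \<omega> n = ?a n"
    using liouville_quotient_ge_1 by (rule exists_irrational_with_partial_quotients)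
  have q: "convergent_denom \<omega> n = cf_den ?a (Suc n)" for n
    by (rule convergent_denom_eq_cf_den[OF liouville_quotient_ge_1 \<omega>(2)])
  show ?thesis
  proof (rule that[OF \<omega>(1)])
    fix n
    show "convergent_denom \<omega> n \<ge> 1" "convergent_denom \<omega> n \<ge> int n"
      unfolding q using cf_den_nonneg_pos cf_den_ge_index liouville_quotient_ge_1 by blast+
    show "partial_quotient \<omega> (n + 1) =
        \<lceil>exp (of_int (convergent_denom \<omega> n) / of_nat (n + 1) :: real)\<rceil>"
      using \<omega>(2) by (simp add: q cf_den_liouville_quotient liouville_quotient_def)
    show "convergent_denom \<omega> (n + 1) \<ge> partial_quotient \<omega> (n + 1) * convergent_denom \<omega> n"
      "convergent_denom \<omega> (n + 1) \<le> (partial_quotient \<omega> (n + 1) + 1) * convergent_denom \<omega> n"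
      using cf_den_nonneg_pos[OF liouville_quotient_ge_1, of n]
        cf_den_le_Suc[OF liouville_quotient_ge_1, of n] \<omega>(2)
      by (auto simp: q algebra_simps)
  qed
qed

section \<open>Summability from exponential decay\<close>

lemma square_le_exp:
  fixes c x :: real
  assumes "c > 0" "x \<ge> 0"
  shows "x\<^sup>2 \<le> 2 / c\<^sup>2 * exp (c * x)"
proof -
  have "(c * x)\<^sup>2 / 2 \<le> exp (c * x)"
    using exp_lower_Taylor_quadratic[of "c * x"] mult_nonneg_nonneg[of c x] assms by linarith
  then show ?thesis using assms by (simp add: field_simps)
qed

text \<open>Half of the decay, exp (- c q), absorbs the square; the other half is at most exp (- c
  n) because q n \<ge> n, which leaves a geometric series.\<close>

lemma summable_of_square_exp_bound:
  fixes f q :: "nat \<Rightarrow> real"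
  assumes c: "c > 0" and q: "\<And>n. q n \<ge> real n"
    and f: "\<And>n. n \<ge> N \<Longrightarrow> 0 \<le> f n \<and> f n \<le> C * (q n)\<^sup>2 * exp (- (2 * c) * q n)"
    and C: "C \<ge> 0"
  shows "summable f"
proof (rule summable_comparison_test')
  show "summable (\<lambda>n. C * (2 / c\<^sup>2) * exp (- c) ^ n)"
    using c by (intro summable_mult summable_geometric) simp
  fix n assume n: "n \<ge> N"
  have q0: "q n \<ge> 0" using q[of n] by simp
  have "f n \<le> C * (q n)\<^sup>2 * exp (- (2 * c) * q n)" using f[OF n] by simp
  also have "\<dots> \<le> C * (2 / c\<^sup>2 * exp (c * q n)) * exp (- (2 * c) * q n)"
    using square_le_exp[OF c q0] C by (intro mult_mono mult_left_mono) auto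
  also have "\<dots> = C * (2 / c\<^sup>2) * (exp (c * q n) * exp (- (2 * c) * q n))"
    by (simp only: mult.assoc)
  also have "exp (c * q n) * exp (- (2 * c) * q n) = exp (- (c * q n))"
    unfolding exp_add[symmetric] by (simp add: algebra_simps)
  also have "C * (2 / c\<^sup>2) * exp (- (c * q n)) \<le> C * (2 / c\<^sup>2) * exp (- (c * real n))"
    using q[of n] c C by (intro mult_left_mono) auto
  also have "exp (- (c * real n)) = exp (- c) ^ n"
    by (simp add: exp_of_nat_mult[symmetric] mult.commute)
  finally show "norm (f n) \<le> C * (2 / c\<^sup>2) * exp (- c) ^ n" using f[OF n] by simp
qed

section \<open>Convergence of both semi-Brjuno series and divergence of the Brjuno series\<close>

theorem lemma5p2:
  shows "\<exists>\<omega>::real. \<omega> \<in> {0<..<1} - \<rat> \<and> semi_brjuno \<omega> \<and> \<not> brjuno \<omega>"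
proof -
  obtain \<omega> where \<omega>: "\<omega> \<in> {0<..<1} - \<rat>"
    and q1: "\<And>n. convergent_denom \<omega> n \<ge> 1" and qn: "\<And>n. convergent_denom \<omega> n \<ge> int n"
    and pq: "\<And>n. partial_quotient \<omega> (n + 1) =
      \<lceil>exp (of_int (convergent_denom \<omega> n) / of_nat (n + 1) :: real)\<rceil>"
    and lower: "\<And>n. convergent_denom \<omega> (n + 1) \<ge> partial_quotient \<omega> (n + 1) * convergent_denom \<omega> n"
    and upper: "\<And>n. convergent_denom \<omega> (n + 1) \<le> (partial_quotient \<omega> (n + 1) + 1) * convergent_denom \<omega> n"
    using exists_irrational_with_exponential_denominators by blast
  define q where "q = (\<lambda>n. real_of_int (convergent_denom \<omega> n))"
  \<comment> \<open>Here \<open>a n\<close> is the quotient with index n + 1, while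
    \<open>q n\<close> is the n-th denominator itself.\<close>
  define a where "a = (\<lambda>n. real_of_int (partial_quotient \<omega> (n + 1)))"
  define e where "e = (\<lambda>n. exp (q n / real (n + 1)))"
  have q1: "q n \<ge> 1" for n using q1[of n] by (simp add: q_def)
  have qn: "q n \<ge> real n" for n
    using qn[of n] unfolding q_def by (metis of_int_le_iff of_int_of_nat_eq)
  have e1: "e n \<ge> 1" for n using q1[of n] by (simp add: e_def)
  have a_ceiling: "a n = of_int \<lceil>e n\<rceil>" for n using pq[of n] by (simp add: a_def e_def q_def)
  have a_lower: "e n \<le> a n" for n by (simp add: a_ceiling)
  have a_upper: "a n \<le> 2 * e n" for n
    using of_int_ceiling_le_add_one[of "e n"] e1[of n] unfolding a_ceiling by linarith
  have a1: "a n \<ge> 1" for n using a_lower e1 order_trans by blast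
  have lower: "q (n + 1) \<ge> a n * q n" for n
    using lower[of n] unfolding q_def a_def by (metis of_int_le_iff of_int_mult)
  have upper: "q (n + 1) \<le> (a n + 1) * q n" for n
    using upper[of n] unfolding q_def a_def by (metis of_int_le_iff of_int_mult of_int_add of_int_1)
  have q_e: "e n \<le> q (n + 1)" for n
  proof -
    have "e n * 1 \<le> a n * q n" using a_lower[of n] q1[of n] e1[of n] by (intro mult_mono) auto
    then show ?thesis using lower[of n] by simp
  qed
  \<comment> \<open>The constant 3 comes from a n + 1 \<le> 2 e n + 1 \<le> 3 e n, as e n \<ge>
    1.\<close>
  have q_3: "q (n + 1) \<le> 3 * q n * e n" for n
  proof -
    have "(a n + 1) * q n \<le> (3 * e n) * q n"
      using a_upper[of n] e1[of n] q1[of n] by (intro mult_right_mono) auto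
    then show ?thesis using upper[of n] by (simp add: mult_ac)
  qed
  have ln_a: "0 \<le> ln (a n)" "ln (a n) \<le> 2 * q n" for n
  proof -
    show "0 \<le> ln (a n)" using a1 by simp
    have "ln (a n) \<le> ln (2 * e n)" using a1[of n] e1[of n] a_upper[of n] by simp
    also have "\<dots> = ln 2 + q n / real (n + 1)" by (simp add: ln_mult e_def)
    also have "q n / real (n + 1) \<le> q n / 1"
      using q1[of n] by (intro divide_left_mono) auto
    \<comment> \<open>ln 2 + q n \<le> 2 q n, because ln 2 < 1 \<le> q n.\<close>
    finally show "ln (a n) \<le> 2 * q n" using q1[of n] ln_2_less_1 by simp
  qed

  \<comment> \<open>Once 1 / (n + 1) < D / 2, the growth e n costs only half of the decay exp (- q n
    D). The remaining rate D / 2 is written 2 (D / 4) to match the summability criterion with c = D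
    / 4.\<close>
  have key: "\<exists>N. \<forall>n\<ge>N. exp (- q n * D) * q (n + 1) \<le> 3 * q n * exp (- (2 * (D / 4)) * q n)"
    if D: "D > 0" for D
  proof -
    obtain N where N: "inverse (real (Suc N)) < D / 2" using reals_Archimedean[of "D / 2"] D by auto
    have "exp (- q n * D) * q (n + 1) \<le> 3 * q n * exp (- (2 * (D / 4)) * q n)" if "n \<ge> N" for n
    proof -
      have "1 / real (n + 1) \<le> inverse (real (Suc N))" using that by (simp add: field_simps)
      then have "q n * (1 / real (n + 1)) \<le> q n * (D / 2)"
        using N q1[of n] by (intro mult_left_mono) auto
      then have e: "e n \<le> exp (q n * D / 2)" by (simp add: e_def)
      have "exp (- q n * D) * q (n + 1) \<le> exp (- q n * D) * (3 * q n * exp (q n * D / 2))"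
        using order_trans[OF q_3[of n] mult_left_mono[OF e, of "3 * q n"]] q1[of n]
        by (intro mult_left_mono) auto
      also have "\<dots> = 3 * q n * (exp (- q n * D) * exp (q n * D / 2))" by simp
      also have "exp (- q n * D) * exp (q n * D / 2) = exp (- (2 * (D / 4)) * q n)"
        unfolding exp_add[symmetric] by (simp add: field_simps)
      finally show ?thesis .
    qed
    then show ?thesis by blast
  qed

  have sum1: "summable (\<lambda>n. brj1_term \<omega> D n)" if D: "D > 0" for D
  proof -
    obtain N where N: "\<And>n. n \<ge> N \<Longrightarrow>
        exp (- q n * D) * q (n + 1) \<le> 3 * q n * exp (- (2 * (D / 4)) * q n)"
      using key[OF D] by blast
    show ?thesis
    proof (rule summable_of_square_exp_bound[where c = "D / 4" and q = q and C = 3 and N = N])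
      fix n assume n: "n \<ge> N"
      have "q n \<le> (q n)\<^sup>2" using q1[of n] by (simp add: power2_eq_square)
      then have "3 * q n * exp (- (2 * (D / 4)) * q n) \<le> 3 * (q n)\<^sup>2 * exp (- (2 * (D / 4)) * q n)"
        by (intro mult_right_mono) auto
      moreover have eq: "brj1_term \<omega> D n = exp (- q n * D) * q (n + 1)"
        by (simp add: brj1_term_def q_def)
      ultimately show "0 \<le> brj1_term \<omega> D n \<and>
          brj1_term \<omega> D n \<le> 3 * (q n)\<^sup>2 * exp (- (2 * (D / 4)) * q n)"
        using order_trans[OF N[OF n]] q1[of "n + 1"] unfolding eq by simp
    qed (use D qn in auto)
  qed
  have sum2: "summable (\<lambda>n. brj2_term \<omega> D n)" if D: "D > 0" for D
  proof -
    obtain N where N: "\<And>n. n \<ge> N \<Longrightarrow>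
        exp (- q n * D) * q (n + 1) \<le> 3 * q n * exp (- (2 * (D / 4)) * q n)"
      using key[OF D] by blast
    show ?thesis
    \<comment> \<open>The factor 3 q n from \<open>key\<close> times the bound 2 q n on ln (a n)
      gives 6 times the square of q n.\<close>
    proof (rule summable_of_square_exp_bound[where c = "D / 4" and q = q and C = 6 and N = N])
      fix n assume n: "n \<ge> N"
      have eq: "brj2_term \<omega> D n = exp (- q n * D) * q (n + 1) * ln (a n)"
        by (simp add: brj2_term_def q_def a_def)
      have "exp (- q n * D) * q (n + 1) * ln (a n) \<le>
          3 * q n * exp (- (2 * (D / 4)) * q n) * (2 * q n)"
        using ln_a(1)[of n] q1[of n] by (intro mult_mono[OF N[OF n] ln_a(2)]) auto
      also have "\<dots> = 6 * (q n)\<^sup>2 * exp (- (2 * (D / 4)) * q n)"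
        by (simp add: power2_eq_square)
      finally show "0 \<le> brj2_term \<omega> D n \<and>
          brj2_term \<omega> D n \<le> 6 * (q n)\<^sup>2 * exp (- (2 * (D / 4)) * q n)"
        using ln_a(1)[of n] q1[of "n + 1"] by (simp add: eq)
    qed (use D qn in auto)
  qed
  \<comment> \<open>\<open>sum2\<close> is taken at D = 2 \<Delta>; starting the series at 1 instead
    of 0 does not affect convergence.\<close>
  have "semi_brjuno \<omega>"
    unfolding semi_brjuno_def using sum1 sum2 by (simp add: summable_Suc_iff)

  moreover have "\<not> brjuno \<omega>"
  proof
    assume "brjuno \<omega>"
    then have "summable (\<lambda>n. brjuno_term \<omega> n)" by (simp add: brjuno_def summable_Suc_iff)
    moreover have "norm (inverse (of_nat (Suc n)) :: real) \<le> brjuno_term \<omega> n" for n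
    proof -
      \<comment> \<open>The q n in the exponent of e n cancels the denominator of the Brjuno term
        and leaves 1 / (n + 1).\<close>
      have "q n / real (n + 1) \<le> ln (q (n + 1))"
        using q_e[of n] q1[of "n + 1"] by (simp add: e_def ln_ge_iff)
      then have "1 / real (n + 1) \<le> ln (q (n + 1)) / q n"
        using q1[of n] by (simp add: field_simps)
      then show ?thesis by (simp add: brjuno_term_def q_def inverse_eq_divide)
    qed
    ultimately have "summable (\<lambda>n. inverse (of_nat (Suc n)) :: real)"
      by (rule summable_comparison_test'[where N = 0])
    then have "summable (\<lambda>n. inverse (of_nat n) :: real)"
      by (subst (asm) summable_Suc_iff)
    then show False using not_summable_harmonic[where 'a = real] by simp
  qed
  ultimately show ?thesis using \<omega> by blast
qed

end
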